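(* Let $n\ge3$, $\frac{\sqrt{n-1}}2<t\le\frac{\sqrt n}2$, and $a^{[n]}:=\frac1{\sqrt n}(1,\dots,1)\in S^{n-1}$. Then for all $a\in S^{n-1}$, $$A(a,t)\le A(a^{[n]},t)=\frac{n^{n/2}}{(n-1)!}\Big(\frac{\sqrt n}2-t\Big)^{n-1}.$$ For $n=2$ the same inequality holds for $\frac38\sqrt2<t\le\frac1{\sqrt2}$, and it fails for some $a$ when $\frac12<t<\frac38\sqrt2$.
   Context: $Q^n=[-\frac12,\frac12]^n\subset\mathbb{R}^n$ is the unit-volume cube. For $a\in S^{n-1}$, $t\in\mathbb{R}$, $H_t(a)=\{x\in\mathbb{R}^n:\langle a,x\rangle=t\}$ and $A(a,t)=\mathrm{vol}_{n-1}(H_t(a)\cap Q^n)$. *)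

theory Defs
  imports "HOL-Analysis.Analysis"
begin

definition cube :: "'a::euclidean_space set" where
  "cube = {x. \<forall>i\<in>Basis. \<bar>x \<bullet> i\<bar> \<le> 1/2}"

definition hyperplane :: "'a::euclidean_space \<Rightarrow> real \<Rightarrow> 'a set" where
  "hyperplane a t = {x. a \<bullet> x = t}"

text \<open>(n-1)-dimensional Lebesgue measure of a set S lying in a hyperplane with
  unit normal a: the induced Lebesgue measure on the hyperplane, realised via the
  product decomposition R^n = a^perp x R a, i.e. as the n-dimensional Lebesgue measure
  of the right cylinder of height 1 over S in direction a.\<close>
definition hvol :: "'a::euclidean_space \<Rightarrow> 'a set \<Rightarrow> real" where
  "hvol a S = measure lebesgue {x + s *\<^sub>R a | x s. x \<in> S \<and> s \<in> {0..1}}"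

definition sec_area :: "'a::euclidean_space \<Rightarrow> real \<Rightarrow> real" where
  "sec_area a t = hvol a (hyperplane a t \<inter> cube)"

definition diagvec :: "real ^ 'n" where
  "diagvec = (\<chi> i. 1 / sqrt (real CARD('n)))"

end

theory Submission
  imports Defs
begin

text \<open>
  By reflections in the coordinate hyperplanes all coordinates of \<open>a\<close> may be taken nonnegative.  Since
  \<open>t > \<surd>(n-1)/2\<close>, the hyperplane can only cut off the corner \<open>(1/2,\<dots>,1/2)\<close> of the cube, so with
  \<open>\<sigma> = \<Sum>a\<^sub>i\<close> the section is empty (\<open>\<sigma> < 2t\<close>) or a simplex of volume
  \<open>(\<sigma>/2 - t)\<^sup>n\<^sup>-\<^sup>1 / ((n-1)! \<Prod>a\<^sub>i)\<close>.

  For \<open>n \<ge> 3\<close> the quotient \<open>(\<sigma> - 2t) / (\<surd>n - 2t)\<close> decreases in \<open>t\<close>, which reduces the claim to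
  \<open>t = \<surd>(n-1)/2\<close>.  Put \<open>b\<^sub>i = \<surd>n a\<^sub>i\<close> with mean \<open>\<beta>\<close>, \<open>q = \<surd>(1-1/n)\<close> and \<open>1 - x\<^sup>2 = (\<beta>-q)/(1-q)\<close>; the claim
  becomes \<open>(1-x\<^sup>2)\<^sup>n\<^sup>-\<^sup>1 \<le> \<Prod>b\<^sub>i\<close>.  The Cauchy--Schwarz inequality gives \<open>\<bar>b\<^sub>i - 1\<bar> \<le> x\<close>, and on this range
  \<open>ln b \<ge> (b-1) - c (b-1)\<^sup>2\<close>, where \<open>c\<close> is chosen so that equality holds at \<open>b = 1 - x\<close>.  Summing over \<open>i\<close>
  turns the claim into an inequality in \<open>x\<close> alone.

  For \<open>n = 2\<close> the claim is equivalent to \<open>(\<surd>2 - 2t)(\<surd>2 + \<sigma>) \<le> 1\<close> for all attainable \<open>\<sigma> < \<surd>2\<close>.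
\<close>

section \<open>A lower bound for products\<close>

text \<open>Let \<open>g\<close> be the right side minus the left. Its derivative has the sign of
  \<open>e * (2 * c * (1 + e) - 1)\<close>, so on the negative side \<open>g\<close> rises from
  \<open>g (- x) = 0\<close> until \<open>2 * c * (1 + e) = 1\<close> and then falls to
  \<open>g 0 = 0\<close>; beyond 0 it rises again.\<close>

lemma ln_one_plus_ge_quadratic:
  fixes e x :: real
  assumes "0 < x" "x < 1" "\<bar>e\<bar> \<le> x"
  defines "c \<equiv> (- x - ln (1 - x)) / x\<^sup>2"
  shows "e - c * e\<^sup>2 \<le> ln (1 + e)"
proof -
  define g where "g e = ln (1 + e) - e + c * e\<^sup>2" for e :: real
  have deriv: "(g has_real_derivative e * (2 * c * (1 + e) - 1) / (1 + e)) (at e)" if "e > -1" for e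
    unfolding g_def using that
    by (auto intro!: derivative_eq_intros simp: field_simps power2_eq_square)
  \<comment> \<open>The second-order Taylor bound for \<open>- ln (1 - x)\<close>; it places the
    critical point \<open>1 / (2 * c) - 1\<close> at or to the left of 0.\<close>
  have c: "2 * c \<ge> 1"
  proof -
    have "x + x\<^sup>2 / 2 \<le> - ln (1 - x)"
    proof -
      have "((\<lambda>x. - ln (1 - x) - x - x\<^sup>2 / 2) has_real_derivative z\<^sup>2 / (1 - z)) (at z)"
        if "0 \<le> z" "z \<le> x" for z
        using that \<open>x < 1\<close> by (auto intro!: derivative_eq_intros simp: field_simps power2_eq_square)
      then have "- ln (1 - 0) - 0 - 0\<^sup>2 / 2 \<le> - ln (1 - x) - x - x\<^sup>2 / 2"
        using assms by (intro DERIV_nonneg_imp_nondecreasing[of 0 x "\<lambda>x. - ln (1 - x) - x - x\<^sup>2 / 2"])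
          (auto intro!: exI)
      then show ?thesis by simp
    qed
    then show ?thesis using \<open>0 < x\<close> by (simp add: c_def field_simps)
  qed
  have "g e \<ge> 0"
  proof (cases "e \<ge> 0 \<or> 2 * c * (1 + e) \<le> 1")
    case True
    then consider "e \<ge> 0" | "e < 0" "2 * c * (1 + e) \<le> 1" by linarith
    then show ?thesis
    proof cases
      case 1
      have "g 0 \<le> g e"
      proof (rule DERIV_nonneg_imp_nondecreasing[OF 1])
        fix z assume z: "0 \<le> z" "z \<le> e"
        have "1 * 1 \<le> (2 * c) * (1 + z)" using c z by (intro mult_mono) auto
        then show "\<exists>y. (g has_real_derivative y) (at z) \<and> 0 \<le> y"
          using z by (intro exI[of _ "z * (2 * c * (1 + z) - 1) / (1 + z)"] conjI deriv) auto
      qed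
      then show ?thesis by (simp add: g_def)
    next
      case 2
      have "g (- x) \<le> g e"
      proof (rule DERIV_nonneg_imp_nondecreasing[of "- x" e g])
        show "- x \<le> e" using assms by auto
        fix z assume z: "- x \<le> z" "z \<le> e"
        have "2 * c * (1 + z) \<le> 2 * c * (1 + e)" using c z by (intro mult_left_mono) auto
        then have "z * (2 * c * (1 + z) - 1) \<ge> 0"
          using 2 z by (intro mult_nonpos_nonpos) auto
        then show "\<exists>y. (g has_real_derivative y) (at z) \<and> 0 \<le> y"
          using z assms by (intro exI[of _ "z * (2 * c * (1 + z) - 1) / (1 + z)"] conjI deriv) auto
      qed
      moreover have "g (- x) = 0"
        using assms by (simp add: g_def)
      ultimately show ?thesis by simp
    qed
  next
    case False
    have "g 0 \<le> g e"
    proof (rule DERIV_nonpos_imp_nonincreasing[of e 0 g])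
      show "e \<le> 0" using False by auto
      fix z assume z: "e \<le> z" "z \<le> 0"
      have "2 * c * (1 + e) \<le> 2 * c * (1 + z)" using c z by (intro mult_left_mono) auto
      then have "z * (2 * c * (1 + z) - 1) \<le> 0"
        using False z by (intro mult_nonpos_nonneg) auto
      then show "\<exists>y. (g has_real_derivative y) (at z) \<and> y \<le> 0"
        using z assms
          by (intro exI[of _ "z * (2 * c * (1 + z) - 1) / (1 + z)"] conjI deriv divide_nonpos_nonneg) auto
    qed
    then show ?thesis by (simp add: g_def)
  qed
  then show ?thesis by (simp add: g_def)
qed

text \<open>The scalar inequality in which the product bound ends. The coefficient 3 is a lower
  bound for \<open>(n - 1) * (1 + q)\<close> when n is at least 3. After splitting
  \<open>1 - x^2\<close> into \<open>(1 - x) * (1 + x)\<close>, the difference \<open>h\<close> of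
  the two sides vanishes at 0 and is nondecreasing.\<close>

lemma three_ln_one_minus_square_le:
  fixes x :: real
  assumes "0 \<le> x" "x < 1"
  shows "3 * ln (1 - x\<^sup>2) \<le> 2 * x + 2 * ln (1 - x) - x\<^sup>2"
proof -
  define h where "h x = 2 * x - x\<^sup>2 - ln (1 - x) - 3 * ln (1 + x)" for x :: real
  have "h 0 \<le> h x"
  proof (rule DERIV_nonneg_imp_nondecreasing[OF assms(1)])
    fix z assume z: "0 \<le> z" "z \<le> x"
    have "(h has_real_derivative 2 - 2 * z + 1 / (1 - z) - 3 / (1 + z)) (at z)"
      unfolding h_def using z assms by (auto intro!: derivative_eq_intros)
    moreover have "2 - 2 * z + 1 / (1 - z) - 3 / (1 + z) = 2 * z * ((1 - z) + z * z) / ((1 - z) * (1 + z))"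
      using z assms by (simp add: divide_simps) (simp add: algebra_simps)
    moreover have "\<dots> \<ge> 0"
      using z assms by (intro divide_nonneg_nonneg mult_nonneg_nonneg add_nonneg_nonneg) auto
    ultimately show "\<exists>y. (h has_real_derivative y) (at z) \<and> 0 \<le> y" by metis
  qed
  moreover have "1 - x\<^sup>2 = (1 - x) * (1 + x)"
    by (simp add: algebra_simps power2_eq_square)
  then have "ln (1 - x\<^sup>2) = ln (1 - x) + ln (1 + x)"
    using assms by (simp add: ln_mult)
  ultimately show ?thesis by (simp add: h_def)
qed

text \<open>Cauchy-Schwarz on the n - 1 entries other than \<open>b k\<close> bounds
  \<open>(e + d)^2\<close> in terms of \<open>d\<close>. The resulting bound on \<open>e\<close> is
  sharp at the end \<open>d = 1 - q\<close>, where one entry is 0 and the others are equal.\<close>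

lemma deviation_le:
  fixes b :: "'i \<Rightarrow> real" and d q :: real
  assumes I: "finite I" "card I = n" "k \<in> I" and "n \<ge> 2"
    and sb: "(\<Sum>i\<in>I. b i) = n * (1 - d)" and sb2: "(\<Sum>i\<in>I. (b i)\<^sup>2) = n"
    and q: "0 \<le> q" "q\<^sup>2 = 1 - 1 / n" and d: "0 \<le> d" "d \<le> 1 - q"
  shows "(1 - q) * (b k - 1)\<^sup>2 \<le> d"
proof -
  define e where "e = b k - 1"
  have S1: "(\<Sum>i\<in>I. b i - 1) = - (n * d)"
    using I sb by (simp add: sum_subtractf algebra_simps)
  have S2: "(\<Sum>i\<in>I. (b i - 1)\<^sup>2) = 2 * n * d"
    using I sb sb2
    by (simp add: power2_diff sum.distrib sum_subtractf sum_distrib_left[symmetric] flip: mult.assoc)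
      (simp add: algebra_simps)
  have "(\<Sum>i\<in>I - {k}. b i - 1) = - (n * d) - e"
    using I S1 by (simp add: sum_diff1 e_def)
  moreover have "(\<Sum>i\<in>I - {k}. (b i - 1)\<^sup>2) = 2 * n * d - e\<^sup>2"
    using I S2 by (simp add: sum_diff1 e_def)
  moreover have "(\<Sum>i\<in>I - {k}. b i - 1)\<^sup>2 \<le> real (card (I - {k})) * (\<Sum>i\<in>I - {k}. (b i - 1)\<^sup>2)"
    using Cauchy_Schwarz_ineq_sum[of "\<lambda>_. 1" "\<lambda>i. b i - 1" "I - {k}"] by simp
  moreover have "real (card (I - {k})) = real n - 1"
    using I \<open>n \<ge> 2\<close> by (simp add: of_nat_diff)
  ultimately have "(- (n * d) - e)\<^sup>2 \<le> (real n - 1) * (2 * n * d - e\<^sup>2)" by simp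
  \<comment> \<open>Completing the square in \<open>e\<close>.\<close>
  then have "real n * (e + d)\<^sup>2 \<le> real n * ((real n - 1) * d * (2 - d))"
    by (simp add: power2_eq_square algebra_simps)
  then have E: "(e + d)\<^sup>2 \<le> (real n - 1) * d * (2 - d)"
    using \<open>n \<ge> 2\<close> by simp
  have q1: "q < 1"
  proof -
    have "q\<^sup>2 < 1\<^sup>2" using q \<open>n \<ge> 2\<close> by simp
    then show ?thesis by (rule power2_less_imp_less) simp
  qed
  \<comment> \<open>\<open>u\<close> is the bound sought for the absolute value of \<open>e\<close>.
    In terms of \<open>u\<close> the goal is \<open>\<bar>e + d\<bar> \<le> u - d\<close>, and
    \<open>u - d = u * (1 - (1 - q) * u)\<close>; n disappears through
    \<open>n * (1 - q) * (1 + q) = 1\<close>.\<close>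
  define u where "u = sqrt (d / (1 - q))"
  have u: "0 \<le> u" "u \<le> 1" "d = (1 - q) * u\<^sup>2"
    using d q1 by (auto simp: u_def)
  have n: "real n * ((1 - q) * (1 + q)) = 1"
    using q(2) \<open>n \<ge> 2\<close> by (simp add: algebra_simps power2_eq_square field_simps)
  have "(real n - 1) * (1 - q) * (1 + q) = q\<^sup>2"
    using n by (simp add: algebra_simps power2_eq_square)
  then have n1: "(real n - 1) * (1 - q) = q\<^sup>2 / (1 + q)"
    using q by (simp add: field_simps)
  have "(1 + q) * (1 - (1 - q) * u)\<^sup>2 - q\<^sup>2 * (2 - d) = (1 - q) * ((1 - u) * (1 + 2 * q - u))"
    unfolding u(3) by algebra
  also have "\<dots> \<ge> 0" using u q q1 by (intro mult_nonneg_nonneg) auto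
  finally have "q\<^sup>2 * (2 - d) / (1 + q) \<le> (1 - (1 - q) * u)\<^sup>2"
    using q(1) by (simp add: pos_divide_le_eq mult.commute)
  then have "u\<^sup>2 * (q\<^sup>2 * (2 - d) / (1 + q)) \<le> u\<^sup>2 * (1 - (1 - q) * u)\<^sup>2"
    by (intro mult_left_mono) auto
  moreover have "(real n - 1) * d * (2 - d) = ((real n - 1) * (1 - q)) * u\<^sup>2 * (2 - d)"
    using u(3) by simp
  then have "(real n - 1) * d * (2 - d) = u\<^sup>2 * (q\<^sup>2 * (2 - d) / (1 + q))"
    by (simp add: n1)
  ultimately have "(e + d)\<^sup>2 \<le> (u * (1 - (1 - q) * u))\<^sup>2"
    using E by (simp add: power_mult_distrib)
  moreover have "0 \<le> u * (1 - (1 - q) * u)"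
  proof -
    have "(1 - q) * u \<le> 1 * 1" using u q q1 by (intro mult_mono) auto
    then show ?thesis using u by simp
  qed
  ultimately have "\<bar>e + d\<bar> \<le> u * (1 - (1 - q) * u)"
    by (metis abs_le_square_iff abs_of_nonneg)
  then have "\<bar>e + d\<bar> \<le> u - d"
    by (simp add: u(3) algebra_simps power2_eq_square)
  then have "\<bar>e\<bar> \<le> u" using d by linarith
  then have "e\<^sup>2 \<le> u\<^sup>2" using abs_le_square_iff[of e u] u by simp
  then have "(1 - q) * e\<^sup>2 \<le> (1 - q) * u\<^sup>2" using q1 by (intro mult_left_mono) auto
  then show ?thesis by (simp add: e_def u(3))
qed

text \<open>After taking logarithms, the quadratic lower bound involves \<open>b\<close> only
  through the sums of \<open>b i - 1\<close> and of their squares, which are \<open>- n * d\<close>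
  and \<open>2 * n * d\<close>. What remains relates \<open>d\<close> and \<open>x\<close>
  alone.\<close>

lemma power_le_prod_of_mean_square_one:
  fixes b :: "'i \<Rightarrow> real" and q \<beta> :: real
  assumes I: "finite I" "card I = n" and n3: "n \<ge> 3" and pos: "\<And>i. i \<in> I \<Longrightarrow> 0 < b i"
    and sb: "(\<Sum>i\<in>I. b i) = n * \<beta>" and sb2: "(\<Sum>i\<in>I. (b i)\<^sup>2) = n"
    and q: "0 \<le> q" "q\<^sup>2 = 1 - 1 / n" and \<beta>: "q < \<beta>"
  shows "((\<beta> - q) / (1 - q)) ^ (n - 1) \<le> (\<Prod>i\<in>I. b i)"
proof -
  define d where "d = 1 - \<beta>"
  have "(\<Sum>i\<in>I. b i)\<^sup>2 \<le> real n * (\<Sum>i\<in>I. (b i)\<^sup>2)"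
    using Cauchy_Schwarz_ineq_sum[of "\<lambda>_. 1" b I] I by simp
  then have "(n * \<beta>)\<^sup>2 \<le> (real n)\<^sup>2" using sb sb2 by (simp add: power2_eq_square)
  then have "n * \<beta> \<le> n" by (rule power2_le_imp_le) simp
  then have "\<beta> \<le> 1" using n3 by simp
  then have d: "0 \<le> d" "d < 1 - q" using \<beta> by (auto simp: d_def)
  then have q1: "q < 1" by simp
  have qhalf: "1 / 2 \<le> q"
  proof (rule power2_le_imp_le[OF _ q(1)])
    show "(1 / 2)\<^sup>2 \<le> q\<^sup>2" using n3 unfolding q(2) by (simp add: field_simps)
  qed
  define x where "x = sqrt (d / (1 - q))"
  have x: "0 \<le> x" "x < 1" "x\<^sup>2 = d / (1 - q)"
    using d by (auto simp: x_def)
  have L: "(\<beta> - q) / (1 - q) = 1 - x\<^sup>2"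
    using q1 by (simp add: x d_def field_simps)
  have dev: "\<bar>b i - 1\<bar> \<le> x" if "i \<in> I" for i
  proof -
    have "(1 - q) * (b i - 1)\<^sup>2 \<le> d"
      by (rule deviation_le[OF I that]) (use n3 sb sb2 q d in \<open>auto simp: d_def\<close>)
    then have "(b i - 1)\<^sup>2 \<le> x\<^sup>2" using q1 by (simp add: x field_simps)
    then show ?thesis using x by (metis abs_le_square_iff abs_of_nonneg)
  qed
  show ?thesis
  proof (cases "x = 0")
    \<comment> \<open>Separated because \<open>c\<close> below divides by \<open>x^2\<close>; here
      all entries equal 1.\<close>
    case True
    then have "\<And>i. i \<in> I \<Longrightarrow> b i = 1" using dev by fastforce
    then show ?thesis by (simp add: L True)
  next
    case False
    define c where "c = (- x - ln (1 - x)) / x\<^sup>2"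
    have cx: "c * x\<^sup>2 = - x - ln (1 - x)" using False by (simp add: c_def)
    have nq: "real n * (1 - q) * (1 + q) = 1"
      using q(2) n3 by (simp add: algebra_simps power2_eq_square field_simps)
    have "d = x\<^sup>2 * (1 - q)" using q1 by (simp add: x)
    then have "n * d * (1 + q) = x\<^sup>2 * (real n * (1 - q) * (1 + q))" by simp
    then have nd: "n * d * (1 + q) = x\<^sup>2" by (simp add: nq)
    \<comment> \<open>The only estimate that depends on n being at least 3: the factors are at least
      2 and 3/2. The logarithm it multiplies is not positive, so replacing the factor by 3 can only
      increase the product.\<close>
    have "3 * 1 \<le> (real n - 1) * (1 + q)"
    proof -
      have "2 * (3 / 2) \<le> (real n - 1) * (1 + q)" using n3 qhalf by (intro mult_mono) auto
      then show ?thesis by simp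
    qed
    moreover have x2: "x\<^sup>2 < 1" using x(1,2) by (simp add: power_less_one_iff)
    then have "ln (1 - x\<^sup>2) \<le> 0" by simp
    ultimately have "(real n - 1) * (1 + q) * ln (1 - x\<^sup>2) \<le> 3 * ln (1 - x\<^sup>2)"
      by (intro mult_right_mono_neg) auto
    also have "\<dots> \<le> 2 * x + 2 * ln (1 - x) - x\<^sup>2"
      by (rule three_ln_one_minus_square_le) (use x in auto)
    also have "\<dots> = - (1 + 2 * c) * (n * d * (1 + q))"
      unfolding nd using cx by (simp add: algebra_simps)
    finally have "(real n - 1) * ln (1 - x\<^sup>2) * (1 + q) \<le> - (1 + 2 * c) * n * d * (1 + q)"
      by (simp add: mult_ac)
    then have "(real n - 1) * ln (1 - x\<^sup>2) \<le> - (1 + 2 * c) * n * d"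
      by (rule mult_right_le_imp_le) (use q in auto)
    also have "\<dots> = (\<Sum>i\<in>I. (b i - 1) - c * (b i - 1)\<^sup>2)"
    proof -
      have "(\<Sum>i\<in>I. (b i - 1)\<^sup>2) = 2 * n * d"
        using I sb sb2
        by (simp add: power2_diff sum.distrib sum_subtractf sum_distrib_left[symmetric] d_def)
          (simp add: algebra_simps)
      moreover have "(\<Sum>i\<in>I. b i - 1) = - (n * d)"
        using I sb by (simp add: sum_subtractf d_def algebra_simps)
      moreover have "(\<Sum>i\<in>I. (b i - 1) - c * (b i - 1)\<^sup>2)
          = (\<Sum>i\<in>I. b i - 1) - c * (\<Sum>i\<in>I. (b i - 1)\<^sup>2)"
        by (simp only: sum_subtractf sum_distrib_left)
      ultimately show ?thesis by (simp add: algebra_simps)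
    qed
    also have "\<dots> \<le> (\<Sum>i\<in>I. ln (b i))"
    proof (rule sum_mono)
      fix i assume "i \<in> I"
      then show "(b i - 1) - c * (b i - 1)\<^sup>2 \<le> ln (b i)"
        using ln_one_plus_ge_quadratic[of x "b i - 1"] dev[of i] x False unfolding c_def by simp
    qed
    also have "\<dots> = ln (\<Prod>i\<in>I. b i)"
      using I by (intro ln_prod[symmetric]) (auto dest: pos)
    also have "(real n - 1) * ln (1 - x\<^sup>2) = ln ((1 - x\<^sup>2) ^ (n - 1))"
      using x2 n3 by (simp add: ln_realpow of_nat_diff)
    finally show ?thesis
      using x2 pos by (simp add: L prod_pos)
  qed
qed

section \<open>The volume of a corner section\<close>

text \<open>Induction on the set of coordinates: fixing the new coordinate at \<open>y\<close>
  leaves a simplex of the same kind with size \<open>t - d b * (c b - y)\<close>, and integrating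
  its volume over \<open>y\<close> raises the power by one.\<close>

lemma emeasure_PiM_scaled_simplex:
  fixes c d :: "'i \<Rightarrow> real"
  assumes "finite A" "\<And>i. i \<in> A \<Longrightarrow> 0 < d i" "0 \<le> t"
  shows "emeasure (Pi\<^sub>M A (\<lambda>_. lborel))
           {x \<in> space (Pi\<^sub>M A (\<lambda>_. lborel)). (\<forall>i\<in>A. x i \<le> c i) \<and> (\<Sum>i\<in>A. d i * (c i - x i)) \<le> t}
         = ennreal (t ^ card A / (fact (card A) * (\<Prod>i\<in>A. d i)))"
  using assms
proof (induction arbitrary: t rule: finite_induct)
  case empty
  then show ?case by (simp add: PiM_empty)
next
  case (insert b A t)
  define S where "S A t = {x \<in> space (Pi\<^sub>M A (\<lambda>_. lborel)).
      (\<forall>i\<in>A. x i \<le> c i) \<and> (\<Sum>i\<in>A. d i * (c i - x i)) \<le> t}" for A t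
  let ?M = "\<lambda>A. (Pi\<^sub>M A (\<lambda>_. lborel :: real measure))"
  define n where "n = card A"
  define P where "P = fact n * (\<Prod>i\<in>A. d i)"
  have P: "P > 0" using insert.prems(1) by (auto simp: P_def intro!: mult_pos_pos prod_pos)
  have db: "d b > 0" using insert.prems(1) by simp
  have meas [measurable]: "S A t \<in> sets (?M A)" if "finite A" for A t
    unfolding S_def using that by measurable
  interpret product_sigma_finite "\<lambda>_. lborel :: real measure" by standard
  have "emeasure (?M (insert b A)) (S (insert b A) t) = (\<integral>\<^sup>+ x. indicator (S (insert b A) t) x \<partial>?M (insert b A))"
    using insert.hyps by (simp add: meas)
  also have "\<dots> = (\<integral>\<^sup>+ y. \<integral>\<^sup>+ x. indicator (S (insert b A) t) (x(b := y)) \<partial>?M A \<partial>lborel)"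
    using insert.hyps by (intro product_nn_integral_insert_rev) (auto simp: meas)
  also have "\<dots> = (\<integral>\<^sup>+ y. \<integral>\<^sup>+ x. indicator {..c b} y * indicator (S A (t - d b * (c b - y))) x \<partial>?M A \<partial>lborel)"
  proof (intro nn_integral_cong)
    fix x and y :: real assume "x \<in> space (?M A)"
    moreover have "(\<Sum>i\<in>A. d i * (c i - (x(b := y)) i)) = (\<Sum>i\<in>A. d i * (c i - x i))"
      using insert.hyps by (intro sum.cong) auto
    moreover have "(\<forall>i\<in>A. (x(b := y)) i \<le> c i) \<longleftrightarrow> (\<forall>i\<in>A. x i \<le> c i)"
      using insert.hyps by auto
    moreover have "x(b := y) \<in> space (?M (insert b A))"
      using \<open>x \<in> space (?M A)\<close> by (auto simp: space_PiM PiE_def extensional_def)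
    ultimately have "x(b := y) \<in> S (insert b A) t \<longleftrightarrow> y \<le> c b \<and> x \<in> S A (t - d b * (c b - y))"
      using insert.hyps unfolding S_def by (auto simp del: fun_upd_apply) (auto simp: fun_upd_same)
    then show "(indicator (S (insert b A) t) (x(b := y)) :: ennreal)
        = indicator {..c b} y * indicator (S A (t - d b * (c b - y))) x"
      by (auto simp: indicator_def)
  qed
  also have "\<dots> = (\<integral>\<^sup>+ y. indicator {..c b} y * emeasure (?M A) (S A (t - d b * (c b - y))) \<partial>lborel)"
    using insert.hyps by (simp add: nn_integral_cmult)
  \<comment> \<open>At \<open>c b - t / d b\<close> the remaining size reaches 0; below that point
    the slice is empty, as all its summands would be nonnegative with negative sum.\<close>
  also have "\<dots> = (\<integral>\<^sup>+ y. ennreal ((t - d b * (c b - y)) ^ n / P) * indicator {c b - t / d b .. c b} y \<partial>lborel)"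
  proof (intro nn_integral_cong)
    fix y
    consider "y > c b" | "y \<le> c b" "t - d b * (c b - y) < 0" | "y \<le> c b" "t - d b * (c b - y) \<ge> 0"
      by linarith
    then show "indicator {..c b} y * emeasure (?M A) (S A (t - d b * (c b - y)))
        = ennreal ((t - d b * (c b - y)) ^ n / P) * indicator {c b - t / d b .. c b} y"
    proof cases
      case 1
      then show ?thesis by (simp add: indicator_def)
    next
      case 2
      have "0 \<le> (\<Sum>i\<in>A. d i * (c i - x i))" if "x \<in> S A t'" for x t'
        using that insert.prems by (intro sum_nonneg mult_nonneg_nonneg) (auto simp: S_def less_imp_le)
      then have "S A (t - d b * (c b - y)) = {}"
        using 2 unfolding S_def by fastforce
      moreover have "y \<notin> {c b - t / d b .. c b}" using 2 db by (auto simp: field_simps)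
      ultimately show ?thesis by simp
    next
      case 3
      then have "y \<in> {c b - t / d b .. c b}" using db by (auto simp: field_simps)
      moreover have "emeasure (?M A) (S A (t - d b * (c b - y))) = ennreal ((t - d b * (c b - y)) ^ n / P)"
        using insert.IH[of "t - d b * (c b - y)"] insert.prems 3 unfolding S_def P_def n_def by simp
      ultimately show ?thesis using 3 by simp
    qed
  qed
  also have "\<dots> = ennreal ((t - d b * (c b - c b)) ^ Suc n / (Suc n * d b * P)
      - (t - d b * (c b - (c b - t / d b))) ^ Suc n / (Suc n * d b * P))"
  proof (rule nn_integral_FTC_Icc[where F = "\<lambda>y. (t - d b * (c b - y)) ^ Suc n / (Suc n * d b * P)"])
    show "(\<lambda>y. (t - d b * (c b - y)) ^ n / P) \<in> borel_measurable borel" by measurable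
    show "c b - t / d b \<le> c b" using insert.prems(2) db by simp
    fix y assume y: "y \<in> {c b - t / d b..c b}"
    then show "0 \<le> (t - d b * (c b - y)) ^ n / P"
      using P db by (intro divide_nonneg_nonneg zero_le_power) (auto simp: field_simps)
    have "((\<lambda>y. (t - d b * (c b - y)) ^ Suc n) has_real_derivative
        real (Suc n) * d b * (t - d b * (c b - y)) ^ n) (at y)"
      by (auto intro!: derivative_eq_intros simp del: power_Suc of_nat_Suc)
    from DERIV_cdivide[OF this, of "Suc n * d b * P"]
    show "((\<lambda>y. (t - d b * (c b - y)) ^ Suc n / (Suc n * d b * P)) has_real_derivative
        (t - d b * (c b - y)) ^ n / P) (at y)"
      using P db by (simp del: power_Suc of_nat_Suc)
  qed
  also have "\<dots> = ennreal (t ^ card (insert b A) / (fact (card (insert b A)) * (\<Prod>i\<in>insert b A. d i)))"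
    using insert.hyps db by (simp add: n_def P_def mult_ac)
  finally show ?case unfolding S_def .
qed

text \<open>
  Shearing along one coordinate \<open>k\<close> so that it becomes \<open>(a \<bullet> x - t) / a\<^sub>k\<close> turns the slices at constant height into translates
  of one simplex in the remaining coordinates.
\<close>
lemma emeasure_PiM_corner_cylinder:
  fixes a :: "'i \<Rightarrow> real" and t :: real
  assumes B: "finite B" "B \<noteq> {}" and pos: "\<And>i. i \<in> B \<Longrightarrow> 0 < a i" and unit: "(\<Sum>i\<in>B. (a i)\<^sup>2) = 1"
    and s: "s = (\<Sum>i\<in>B. a i) / 2 - t" "0 \<le> s"
  shows "emeasure (Pi\<^sub>M B (\<lambda>_. lborel))
      {x \<in> space (Pi\<^sub>M B (\<lambda>_. lborel)). 0 \<le> (\<Sum>i\<in>B. a i * x i) - t \<and> (\<Sum>i\<in>B. a i * x i) - t \<le> 1 \<and>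
         (\<forall>i\<in>B. x i - ((\<Sum>i\<in>B. a i * x i) - t) * a i \<le> 1 / 2)}
    = ennreal (s ^ (card B - 1) / (fact (card B - 1) * (\<Prod>i\<in>B. a i)))" (is "emeasure _ ?X = _")
proof -
  obtain k where k: "k \<in> B" using B by auto
  define A where "A = B - {k}"
  have BA: "B = insert k A" "k \<notin> A" "finite A" using k B by (auto simp: A_def)
  have ak: "a k > 0" using pos k by simp
  let ?M = "\<lambda>A. (Pi\<^sub>M A (\<lambda>_. lborel :: real measure))"
  interpret product_sigma_finite "\<lambda>_. lborel :: real measure" by standard
  \<comment> \<open>\<open>Y\<close> is the sheared cylinder: the height is now
    \<open>a k * x k\<close>, and the constraint on coordinate \<open>k\<close> has become the bound
    on the weighted sum over \<open>A\<close>.\<close>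
  define Y where "Y = {x \<in> space (?M (insert k A)). 0 \<le> a k * x k \<and> a k * x k \<le> 1 \<and>
      (\<forall>i\<in>A. x i \<le> 1 / 2 + a k * x k * a i) \<and> (\<Sum>i\<in>A. a i * (1 / 2 + a k * x k * a i - x i)) \<le> s}"
  have X [measurable]: "?X \<in> sets (?M (insert k A))"
    unfolding BA(1) using B(1)[unfolded BA(1)] by measurable
  have "(\<lambda>x. x i) \<in> borel_measurable (?M (insert k A))" if "i \<in> insert k A" for i
    using measurable_component_singleton[OF that, of "\<lambda>_. lborel"] by simp
  then have Y: "Y \<in> sets (?M (insert k A))"
    unfolding Y_def using BA(3)
    by (intro sets.sets_Collect_conj sets.sets_Collect_finite_All borel_measurable_le borel_measurable_sum
        borel_measurable_times borel_measurable_add borel_measurable_diff borel_measurable_const) auto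
  have sumA2: "(\<Sum>i\<in>A. (a i)\<^sup>2) = 1 - (a k)\<^sup>2" and sumA: "(\<Sum>i\<in>A. a i) = 2 * (s + t) - a k"
    using unit s BA by (auto simp: field_simps)
  \<comment> \<open>For fixed remaining coordinates the shear is a translation in \<open>y\<close>;
    the factor \<open>1\<close> is kept to fit the affine substitution rule
    \<open>nn_integral_real_affine\<close>.\<close>
  have shear: "x(k := (t - (\<Sum>i\<in>A. a i * x i)) / a k + 1 * y) \<in> ?X \<longleftrightarrow> x(k := y) \<in> Y"
    if x: "x \<in> space (?M A)" for x y
  proof -
    define z where "z = (t - (\<Sum>i\<in>A. a i * x i)) / a k + 1 * y"
    have sum_upd: "(\<Sum>i\<in>A. g i ((x(k := w)) i)) = (\<Sum>i\<in>A. g i (x i))" for g :: "_ \<Rightarrow> real \<Rightarrow> real" and w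
      using BA by (intro sum.cong) auto
    have "(\<Sum>i\<in>B. a i * (x(k := z)) i) - t = a k * z + (\<Sum>i\<in>A. a i * x i) - t"
      using BA sum_upd[of "\<lambda>i v. a i * v"] by simp
    also have "\<dots> = a k * y" using ak by (simp add: z_def field_simps)
    finally have 1: "(\<Sum>i\<in>B. a i * (x(k := z)) i) - t = a k * y" .
    have "(\<Sum>i\<in>A. a i * (1 / 2 + a k * y * a i - x i))
        = (\<Sum>i\<in>A. a i) / 2 + a k * y * (\<Sum>i\<in>A. (a i)\<^sup>2) - (\<Sum>i\<in>A. a i * x i)"
      by (simp add: sum.distrib sum_subtractf sum_distrib_left sum_divide_distrib algebra_simps power2_eq_square)
    also have "\<dots> = s + (t - (\<Sum>i\<in>A. a i * x i) + a k * y - a k * (a k * y * a k + 1 / 2))"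
      unfolding sumA sumA2 by (simp add: field_simps power2_eq_square)
    also have "\<dots> = s + a k * (z - (a k * y) * a k - 1 / 2)"
      using ak by (simp add: z_def field_simps)
    finally have 2: "z - (a k * y) * a k \<le> 1 / 2 \<longleftrightarrow> (\<Sum>i\<in>A. a i * (1 / 2 + a k * y * a i - x i)) \<le> s"
      using ak by (simp add: mult_le_0_iff)
    have 3: "x(k := w) \<in> space (?M (insert k A))" for w
      using x by (auto simp: space_PiM PiE_def extensional_def)
    have "x(k := z) \<in> ?X \<longleftrightarrow> 0 \<le> a k * y \<and> a k * y \<le> 1 \<and> z - (a k * y) * a k \<le> 1 / 2 \<and>
        (\<forall>i\<in>A. x i - (a k * y) * a i \<le> 1 / 2)"
      unfolding mem_Collect_eq 1 using 3 BA by auto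
    also have "\<dots> \<longleftrightarrow> x(k := y) \<in> Y"
      unfolding Y_def mem_Collect_eq 2
      using 3 BA sum_upd[of "\<lambda>i v. a i * (1 / 2 + a k * y * a i - v)"]
      by (auto simp: algebra_simps)
    finally show ?thesis by (simp add: z_def)
  qed
  define K where "K = s ^ card A / (fact (card A) * (\<Prod>i\<in>A. a i))"
  have K: "K \<ge> 0"
    unfolding K_def using s pos BA by (intro divide_nonneg_nonneg mult_nonneg_nonneg prod_nonneg) (auto simp: less_imp_le)
  have "emeasure (?M B) ?X = (\<integral>\<^sup>+ x. indicator ?X x \<partial>?M (insert k A))"
    using X BA(1) by simp
  also have "\<dots> = (\<integral>\<^sup>+ x. \<integral>\<^sup>+ y. indicator ?X (x(k := y)) \<partial>lborel \<partial>?M A)"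
    using BA by (intro product_nn_integral_insert borel_measurable_indicator X) auto
  also have "\<dots> = (\<integral>\<^sup>+ x. \<integral>\<^sup>+ y. indicator Y (x(k := y)) \<partial>lborel \<partial>?M A)"
  proof (rule nn_integral_cong)
    fix x assume x: "x \<in> space (?M A)"
    have "(\<lambda>y. x(k := y)) \<in> borel \<rightarrow>\<^sub>M ?M (insert k A)"
      using x by measurable
    then have "(\<lambda>y. indicator ?X (x(k := y)) :: ennreal) \<in> borel_measurable borel"
      by measurable
    then have "(\<integral>\<^sup>+ y. indicator ?X (x(k := y)) \<partial>lborel)
      = ennreal \<bar>1\<bar> * (\<integral>\<^sup>+ y. indicator ?X (x(k := (t - (\<Sum>i\<in>A. a i * x i)) / a k + 1 * y)) \<partial>lborel)"
      by (rule nn_integral_real_affine) simp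
    also have "\<dots> = (\<integral>\<^sup>+ y. indicator Y (x(k := y)) \<partial>lborel)"
      using shear[OF x] by (simp add: indicator_def cong: nn_integral_cong)
    finally show "(\<integral>\<^sup>+ y. indicator ?X (x(k := y)) \<partial>lborel) = (\<integral>\<^sup>+ y. indicator Y (x(k := y)) \<partial>lborel)" .
  qed
  \<comment> \<open>The translation needed \<open>y\<close> as the inner variable; slicing at
    constant height needs it as the outer one.\<close>
  also have "\<dots> = (\<integral>\<^sup>+ y. \<integral>\<^sup>+ x. indicator Y (x(k := y)) \<partial>?M A \<partial>lborel)"
    using product_nn_integral_insert[OF BA(3,2), of "indicator Y"]
      product_nn_integral_insert_rev[OF BA(3,2), of "indicator Y"] Y by simp
  \<comment> \<open>The corner of the slice moves with \<open>y\<close> but its volume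
    \<open>K\<close> does not change. Heights from 0 to 1 correspond to \<open>y\<close> from 0 to
    \<open>1 / a k\<close>, which supplies the missing factor of the product over
    \<open>B\<close>.\<close>
  also have "\<dots> = (\<integral>\<^sup>+ y. ennreal K * indicator {0..1 / a k} y \<partial>lborel)"
  proof (intro nn_integral_cong)
    fix y :: real
    define S where "S = {x \<in> space (?M A). (\<forall>i\<in>A. x i \<le> 1 / 2 + a k * y * a i) \<and>
      (\<Sum>i\<in>A. a i * (1 / 2 + a k * y * a i - x i)) \<le> s}"
    have [measurable]: "S \<in> sets (?M A)" unfolding S_def using BA(3) by measurable
    have "(\<integral>\<^sup>+ x. indicator Y (x(k := y)) \<partial>?M A) = (\<integral>\<^sup>+ x. indicator {0..1 / a k} y * indicator S x \<partial>?M A)"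
    proof (intro nn_integral_cong)
      fix x assume x: "x \<in> space (?M A)"
      have "x(k := y) \<in> space (?M (insert k A))"
        using x by (auto simp: space_PiM PiE_def extensional_def)
      moreover have "(\<Sum>i\<in>A. a i * (1 / 2 + a k * y * a i - (x(k := y)) i))
          = (\<Sum>i\<in>A. a i * (1 / 2 + a k * y * a i - x i))"
        using BA by (intro sum.cong) auto
      ultimately have "x(k := y) \<in> Y \<longleftrightarrow> y \<in> {0..1 / a k} \<and> x \<in> S"
        using x BA ak by (auto simp: Y_def S_def field_simps zero_le_mult_iff)
      then show "(indicator Y (x(k := y)) :: ennreal) = indicator {0..1 / a k} y * indicator S x"
        by (auto simp: indicator_def)
    qed
    also have "\<dots> = indicator {0..1 / a k} y * emeasure (?M A) S"
      by (simp add: nn_integral_cmult)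
    also have "emeasure (?M A) S = ennreal K"
      unfolding S_def K_def using BA pos s by (intro emeasure_PiM_scaled_simplex) auto
    finally show "(\<integral>\<^sup>+ x. indicator Y (x(k := y)) \<partial>?M A) = ennreal K * indicator {0..1 / a k} y"
      by (simp only: mult.commute)
  qed
  also have "\<dots> = ennreal (K * (1 / a k))"
    using ak K by (simp add: nn_integral_cmult) (simp add: ennreal_mult[symmetric])
  also have "K * (1 / a k) = s ^ (card B - 1) / (fact (card B - 1) * (\<Prod>i\<in>B. a i))"
    using BA by (simp add: K_def)
  finally show ?thesis .
qed

text \<open>A point \<open>p = x + r *\<^sub>R a\<close> over the hyperplane has height
  \<open>r = a \<bullet> p - t\<close> and foot \<open>p - r *\<^sub>R a\<close>, so the set is a
  cylinder of height 1. It is closed, hence Borel, and its measure can be computed in the product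
  measure over \<open>Basis\<close>.\<close>

lemma measure_corner_cylinder:
  fixes a :: "'a::euclidean_space"
  assumes pos: "\<And>b. b \<in> Basis \<Longrightarrow> 0 < a \<bullet> b" and "norm a = 1"
    and s: "s = (\<Sum>b\<in>Basis. a \<bullet> b) / 2 - t" "0 \<le> s"
  shows "measure lebesgue {p. 0 \<le> a \<bullet> p - t \<and> a \<bullet> p - t \<le> 1 \<and>
           (\<forall>b\<in>Basis. p \<bullet> b - (a \<bullet> p - t) * (a \<bullet> b) \<le> 1 / 2)}
       = s ^ (DIM('a) - 1) / (fact (DIM('a) - 1) * (\<Prod>b\<in>Basis. a \<bullet> b))" (is "measure _ ?C = _")
proof -
  let ?M = "Pi\<^sub>M (Basis :: 'a set) (\<lambda>_. lborel :: real measure)"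
  have "closed ?C"
    unfolding Ball_def
    by (intro closed_Collect_conj closed_Collect_all closed_Collect_imp closed_Collect_le continuous_intros open_Collect_const)
  then have C [measurable]: "?C \<in> sets borel" by (rule borel_closed)
  have inner: "a \<bullet> (\<Sum>b\<in>Basis. f b *\<^sub>R b) = (\<Sum>b\<in>Basis. (a \<bullet> b) * f b)" for f
    by (simp add: inner_sum_right mult.commute)
  have "emeasure lborel ?C
      = emeasure ?M ((\<lambda>f. \<Sum>b\<in>Basis. f b *\<^sub>R b) -` ?C \<inter> space ?M)"
    by (subst lborel_eq) (simp add: emeasure_distr)
  also have "(\<lambda>f. \<Sum>b\<in>Basis. f b *\<^sub>R b) -` ?C \<inter> space ?M
     = {x \<in> space ?M. 0 \<le> (\<Sum>i\<in>Basis. (a \<bullet> i) * x i) - t \<and> (\<Sum>i\<in>Basis. (a \<bullet> i) * x i) - t \<le> 1 \<and>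
         (\<forall>i\<in>Basis. x i - ((\<Sum>i\<in>Basis. (a \<bullet> i) * x i) - t) * (a \<bullet> i) \<le> 1 / 2)}"
    by (auto simp: inner)
  also have "emeasure ?M \<dots>
      = ennreal (s ^ (card (Basis :: 'a set) - 1) / (fact (card (Basis :: 'a set) - 1) * (\<Prod>i\<in>Basis. a \<bullet> i)))"
    using pos s \<open>norm a = 1\<close>
    by (intro emeasure_PiM_corner_cylinder)
      (auto simp: norm_eq_1 power2_eq_square simp flip: euclidean_inner)
  finally have "measure lborel ?C = s ^ (DIM('a) - 1) / (fact (DIM('a) - 1) * (\<Prod>b\<in>Basis. a \<bullet> b))"
    using pos s by (simp add: measure_def prod_nonneg less_imp_le)
  then show ?thesis using C by (simp add: measure_completion)
qed

section \<open>Sections of the cube and reduction to positive normals\<close>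

lemma sum_le_sqrt_card:
  fixes f :: "'i \<Rightarrow> real"
  assumes "(\<Sum>i\<in>A. (f i)\<^sup>2) \<le> 1"
  shows "(\<Sum>i\<in>A. f i) \<le> sqrt (card A)"
proof -
  have "(\<Sum>i\<in>A. f i)\<^sup>2 \<le> card A * (\<Sum>i\<in>A. (f i)\<^sup>2)"
    using Cauchy_Schwarz_ineq_sum[of "\<lambda>_. 1" f A] by simp
  also have "\<dots> \<le> card A" using assms by (simp add: mult_left_le)
  finally show ?thesis by (rule real_le_rsqrt)
qed

text \<open>The origin of the threshold \<open>sqrt (n - 1) / 2\<close>: beyond it the section
  avoids the lower faces, and a normal with a zero coordinate has an empty section.\<close>

lemma sum_Basis_minus_le:
  fixes a :: "'a::euclidean_space"
  assumes "norm a = 1" "k \<in> Basis"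
  shows "(\<Sum>b\<in>Basis - {k}. a \<bullet> b) \<le> sqrt (real DIM('a) - 1)"
proof -
  have "(\<Sum>b\<in>Basis. (a \<bullet> b)\<^sup>2) = 1"
    using assms(1) by (simp add: norm_eq_1 power2_eq_square flip: euclidean_inner)
  then have "(\<Sum>b\<in>Basis - {k}. (a \<bullet> b)\<^sup>2) \<le> 1"
    using sum_diff1[of Basis "\<lambda>b. (a \<bullet> b)\<^sup>2" k] assms(2) by simp
  from sum_le_sqrt_card[OF this] show ?thesis
    using assms(2) DIM_positive[where 'a='a] by (simp add: of_nat_diff)
qed

text \<open>If all coordinates of a point on the hyperplane are at most 1/2, those other than
  \<open>k\<close> contribute at most \<open>t\<close> to \<open>a \<bullet> x\<close>, so
  \<open>x \<bullet> k\<close> is nonnegative. Hence the lower faces impose no condition and the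
  cylinder in \<open>hvol\<close> is the corner cylinder.\<close>

lemma sec_area_corner:
  fixes a :: "'a::euclidean_space"
  assumes pos: "\<And>b. b \<in> Basis \<Longrightarrow> 0 < a \<bullet> b" and "norm a = 1"
    and t: "sqrt (real DIM('a) - 1) / 2 \<le> t"
    and s: "s = (\<Sum>b\<in>Basis. a \<bullet> b) / 2 - t" "0 \<le> s"
  shows "sec_area a t = s ^ (DIM('a) - 1) / (fact (DIM('a) - 1) * (\<Prod>b\<in>Basis. a \<bullet> b))"
proof -
  have aa: "a \<bullet> a = 1" using \<open>norm a = 1\<close> by (simp add: norm_eq_1)
  have cube: "x \<in> cube" if x: "a \<bullet> x = t" "\<forall>b\<in>Basis. x \<bullet> b \<le> 1 / 2" for x
  proof -
    have "- (1 / 2) \<le> x \<bullet> k" if k: "k \<in> Basis" for k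
    proof -
      have "t = (a \<bullet> k) * (x \<bullet> k) + (\<Sum>b\<in>Basis - {k}. (a \<bullet> b) * (x \<bullet> b))"
        using x(1) k by (simp add: euclidean_inner[of a x] sum.remove)
      also have "(\<Sum>b\<in>Basis - {k}. (a \<bullet> b) * (x \<bullet> b)) \<le> (\<Sum>b\<in>Basis - {k}. (a \<bullet> b) * (1 / 2))"
        using x(2) pos by (intro sum_mono mult_left_mono) (auto simp: less_imp_le)
      also have "\<dots> = (\<Sum>b\<in>Basis - {k}. a \<bullet> b) / 2"
        by (simp add: sum_divide_distrib)
      also have "\<dots> \<le> t"
        using sum_Basis_minus_le[OF \<open>norm a = 1\<close> k] t by simp
      finally have "0 \<le> (a \<bullet> k) * (x \<bullet> k)" by simp
      then have "0 \<le> x \<bullet> k" using pos[OF k] by (simp add: zero_le_mult_iff)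
      then show ?thesis by simp
    qed
    then show ?thesis using x(2) by (force simp: cube_def abs_le_iff)
  qed
  have "{x + r *\<^sub>R a | x r. x \<in> hyperplane a t \<inter> cube \<and> r \<in> {0..1}}
     = {p. 0 \<le> a \<bullet> p - t \<and> a \<bullet> p - t \<le> 1 \<and> (\<forall>b\<in>Basis. p \<bullet> b - (a \<bullet> p - t) * (a \<bullet> b) \<le> 1 / 2)}"
    (is "?L = ?R")
  proof (intro equalityI subsetI)
    fix p assume "p \<in> ?L"
    then obtain x r where "p = x + r *\<^sub>R a" "a \<bullet> x = t" "x \<in> cube" "r \<in> {0..1}"
      by (auto simp: hyperplane_def)
    then show "p \<in> ?R"
      by (auto simp: inner_add_right inner_add_left aa cube_def abs_le_iff)
  next
    fix p assume p: "p \<in> ?R"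
    define x where "x = p - (a \<bullet> p - t) *\<^sub>R a"
    have "a \<bullet> x = t" by (simp add: x_def inner_diff_right aa)
    moreover have "x \<in> cube"
      using p by (intro cube \<open>a \<bullet> x = t\<close>) (simp add: x_def inner_diff_left)
    moreover have "p = x + (a \<bullet> p - t) *\<^sub>R a" by (simp add: x_def)
    moreover have "a \<bullet> p - t \<in> {0..1}" using p by simp
    ultimately show "p \<in> ?L"
      unfolding hyperplane_def by blast
  qed
  then show ?thesis
    unfolding sec_area_def hvol_def using measure_corner_cylinder[OF pos \<open>norm a = 1\<close> s] by simp
qed

lemma inner_le_sum_abs_cube:
  fixes x :: "'a::euclidean_space"
  assumes "x \<in> cube"
  shows "a \<bullet> x \<le> (\<Sum>b\<in>Basis. \<bar>a \<bullet> b\<bar>) / 2"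
proof -
  have "(a \<bullet> b) * (x \<bullet> b) \<le> \<bar>a \<bullet> b\<bar> * (1 / 2)" if "b \<in> Basis" for b
  proof -
    have "(a \<bullet> b) * (x \<bullet> b) \<le> \<bar>a \<bullet> b\<bar> * \<bar>x \<bullet> b\<bar>"
      by (simp flip: abs_mult)
    also have "\<dots> \<le> \<bar>a \<bullet> b\<bar> * (1 / 2)"
      using that assms unfolding cube_def by (intro mult_left_mono) auto
    finally show ?thesis .
  qed
  then have "a \<bullet> x \<le> (\<Sum>b\<in>Basis. \<bar>a \<bullet> b\<bar> * (1 / 2))"
    unfolding euclidean_inner[of a x] by (rule sum_mono)
  then show ?thesis by (simp add: sum_divide_distrib)
qed

lemma sec_area_eq_0:
  fixes a :: "'a::euclidean_space"
  assumes "(\<Sum>b\<in>Basis. \<bar>a \<bullet> b\<bar>) / 2 < t"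
  shows "sec_area a t = 0"
proof -
  have "hyperplane a t \<inter> cube = {}"
    using inner_le_sum_abs_cube[of _ a] assms by (fastforce simp: hyperplane_def)
  then show ?thesis by (simp add: sec_area_def hvol_def)
qed

text \<open>Reflecting the coordinates in which \<open>a\<close> is negative is a linear isometry
  that preserves the cube and Lebesgue measure and carries the cylinder over one section to that
  over the other.\<close>

lemma sec_area_abs:
  fixes a :: "'a::euclidean_space"
  shows "sec_area (\<Sum>b\<in>Basis. \<bar>a \<bullet> b\<bar> *\<^sub>R b) t = sec_area a t"
proof -
  \<comment> \<open>A zero coordinate receives 1, where \<open>sgn\<close> would make
    \<open>R\<close> singular. The summand 0 in \<open>R\<close> gives it the shape required by
    \<open>lebesgue_affine_euclidean\<close>.\<close>
  define c where "c b = (if a \<bullet> b < 0 then - 1 else 1 :: real)" for b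
  define R where "R x = 0 + (\<Sum>b\<in>Basis. (c b * (x \<bullet> b)) *\<^sub>R b)" for x :: 'a
  have Rb: "R x \<bullet> b = c b * (x \<bullet> b)" if "b \<in> Basis" for x b
    using that by (simp add: R_def)
  have RR: "R (R x) = x" for x
    by (rule euclidean_eqI) (simp add: Rb c_def)
  have Rin: "R x \<bullet> R y = x \<bullet> y" for x y
    unfolding euclidean_inner[of "R x" "R y"] euclidean_inner[of x y] by (intro sum.cong) (auto simp: Rb c_def)
  have Rlin: "R (x + r *\<^sub>R y) = R x + r *\<^sub>R R y" for x y r
    by (rule euclidean_eqI) (simp add: Rb inner_add_left algebra_simps)
  have Rcube: "R x \<in> cube \<longleftrightarrow> x \<in> cube" for x
    by (auto simp: cube_def Rb abs_mult c_def)
  have Ra: "R a = (\<Sum>b\<in>Basis. \<bar>a \<bullet> b\<bar> *\<^sub>R b)"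
    by (auto simp: R_def c_def intro!: sum.cong)
  define C where "C a = {x + s *\<^sub>R a | x s. x \<in> hyperplane a t \<inter> cube \<and> s \<in> {0..1}}" for a :: 'a
  have RC: "R p \<in> C (R v)" if p: "p \<in> C v" for p v
  proof -
    obtain x r where "p = x + r *\<^sub>R v" "v \<bullet> x = t" "x \<in> cube" "r \<in> {0..1}"
      using p by (auto simp: C_def hyperplane_def)
    then have "R p = R x + r *\<^sub>R R v" "R x \<in> hyperplane (R v) t \<inter> cube"
      by (auto simp: Rlin hyperplane_def Rin Rcube)
    then show ?thesis using \<open>r \<in> {0..1}\<close> unfolding C_def by blast
  qed
  have vim: "R -` C (R a) = C a"
  proof (intro equalityI subsetI)
    fix p assume "p \<in> R -` C (R a)"
    then have "R (R p) \<in> C (R (R a))" by (rule RC[OF vimageD])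
    then show "p \<in> C a" by (simp add: RR)
  qed (simp add: RC)
  have nz: "\<And>j. j \<in> Basis \<Longrightarrow> c j \<noteq> 0" by (simp add: c_def)
  have c1: "(\<Prod>j\<in>Basis. \<bar>c j\<bar>) = 1" by (intro prod.neutral) (auto simp: c_def)
  have "lebesgue = density (distr lebesgue lebesgue R) (\<lambda>_. ennreal (\<Prod>j\<in>Basis. \<bar>c j\<bar>))"
    using lebesgue_affine_euclidean[of c 0, OF nz] unfolding R_def .
  also have "\<dots> = distr lebesgue lebesgue R"
    by (simp only: c1 ennreal_1 density_1)
  finally have leb: "lebesgue = distr lebesgue lebesgue R" .
  have Rm: "R \<in> lebesgue \<rightarrow>\<^sub>M lebesgue"
    using lebesgue_affine_measurable[of c 0, OF nz] unfolding R_def .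
  \<comment> \<open>Compactness is used for the measurability that \<open>measure_distr\<close>
    demands.\<close>
  have "compact (C v)" for v
  proof -
    have "compact (hyperplane v t \<inter> cube)"
    proof -
      define u :: 'a where "u = (\<Sum>b\<in>Basis. (1 / 2) *\<^sub>R b)"
      have u: "u \<bullet> b = 1 / 2" if "b \<in> Basis" for b using that by (simp add: u_def)
      have "x \<in> cube \<longleftrightarrow> x \<in> cbox (- u) u" for x
        unfolding cube_def mem_box mem_Collect_eq by (intro ball_cong refl) (auto simp: u)
      then have "cube = cbox (- u) u" by blast
      moreover have "closed (hyperplane v t)"
        unfolding hyperplane_def by (rule closed_hyperplane)
      ultimately show ?thesis by (metis closed_Int_compact compact_cbox)
    qed
    then have "compact ((\<lambda>(x, s). x + s *\<^sub>R v) ` ((hyperplane v t \<inter> cube) \<times> {0..1}))"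
      by (intro compact_continuous_image compact_Times) (auto simp: split_beta intro!: continuous_intros)
    moreover have "(\<lambda>(x, s). x + s *\<^sub>R v) ` ((hyperplane v t \<inter> cube) \<times> {0..1}) = C v"
      by (auto simp: C_def image_iff) blast
    ultimately show ?thesis by simp
  qed
  then have "C (R a) \<in> sets lebesgue" by (simp add: lmeasurable_compact fmeasurableD)
  then have "measure (distr lebesgue lebesgue R) (C (R a)) = measure lebesgue (C a)"
    using Rm vim by (subst measure_distr) auto
  then have "measure lebesgue (C (R a)) = measure lebesgue (C a)"
    using arg_cong[OF leb, of "\<lambda>M. measure M (C (R a))"] by (rule trans[rotated])
  then show ?thesis
    unfolding sec_area_def hvol_def C_def[symmetric] Ra[symmetric] .
qed

text \<open>After reflection the coordinates are nonnegative. Either the section is empty, or none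
  of them vanishes, since a zero coordinate would force the coordinate sum below
  \<open>2 * t\<close>; then the corner formula applies.\<close>

lemma sec_area_le:
  fixes a :: "'a::euclidean_space"
  assumes "norm a = 1" and t: "sqrt (real DIM('a) - 1) / 2 < t" and "0 \<le> M"
    and bound: "\<And>v :: 'a. norm v = 1 \<Longrightarrow> (\<And>b. b \<in> Basis \<Longrightarrow> 0 < v \<bullet> b) \<Longrightarrow> t \<le> (\<Sum>b\<in>Basis. v \<bullet> b) / 2 \<Longrightarrow>
      ((\<Sum>b\<in>Basis. v \<bullet> b) / 2 - t) ^ (DIM('a) - 1) / (fact (DIM('a) - 1) * (\<Prod>b\<in>Basis. v \<bullet> b)) \<le> M"
  shows "sec_area a t \<le> M"
proof -
  define v where "v = (\<Sum>b\<in>Basis. \<bar>a \<bullet> b\<bar> *\<^sub>R b)"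
  have vb: "v \<bullet> b = \<bar>a \<bullet> b\<bar>" if "b \<in> Basis" for b
    using that by (simp add: v_def)
  have "v \<bullet> v = a \<bullet> a"
    unfolding euclidean_inner[of v v] euclidean_inner[of a a] by (intro sum.cong) (auto simp: vb)
  then have v1: "norm v = 1" using \<open>norm a = 1\<close> by (simp add: norm_eq_sqrt_inner)
  have "sec_area v t \<le> M"
  proof (cases "(\<Sum>b\<in>Basis. v \<bullet> b) / 2 < t")
    case True
    then have "(\<Sum>b\<in>Basis. \<bar>v \<bullet> b\<bar>) / 2 < t" by (simp add: vb cong: sum.cong)
    then show ?thesis using sec_area_eq_0 \<open>0 \<le> M\<close> by metis
  next
    case False
    have pos: "0 < v \<bullet> k" if k: "k \<in> Basis" for k
    proof (rule ccontr)
      assume "\<not> 0 < v \<bullet> k"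
      then have "v \<bullet> k = 0" using vb[OF k] by simp
      then have "(\<Sum>b\<in>Basis. v \<bullet> b) = (\<Sum>b\<in>Basis - {k}. v \<bullet> b)"
        using k by (simp add: sum.remove)
      then show False using sum_Basis_minus_le[OF v1 k] t False by simp
    qed
    show ?thesis
      using sec_area_corner[OF pos v1 less_imp_le[OF t] refl] bound[OF v1 pos] False by simp
  qed
  then show ?thesis by (simp add: v_def sec_area_abs)
qed

section \<open>Comparison with the diagonal direction\<close>

text \<open>Lowering \<open>2 * t\<close> to \<open>m = sqrt (n - 1)\<close> can only increase the
  ratio of \<open>\<sigma> - 2 * t\<close> to \<open>sqrt n - 2 * t\<close>. At that value the claim
  is the product bound for \<open>b i = sqrt n * a i\<close> with mean
  \<open>\<sigma> / sqrt n\<close>.\<close>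

lemma corner_power_le_prod:
  fixes a :: "'i \<Rightarrow> real"
  assumes I: "finite I" "card I = n" "n \<ge> 3" and pos: "\<And>i. i \<in> I \<Longrightarrow> 0 < a i"
    and unit: "(\<Sum>i\<in>I. (a i)\<^sup>2) = 1"
    and t: "sqrt (real n - 1) / 2 < t" "t \<le> (\<Sum>i\<in>I. a i) / 2"
  shows "((\<Sum>i\<in>I. a i) / 2 - t) ^ (n - 1) \<le> sqrt n ^ n * (\<Prod>i\<in>I. a i) * (sqrt n / 2 - t) ^ (n - 1)"
proof -
  define \<sigma> m q where "\<sigma> = (\<Sum>i\<in>I. a i)" and "m = sqrt (real n - 1)" and "q = m / sqrt n"
  have n: "sqrt n > 0" "real n \<ge> 3" using I by auto
  have \<sigma>: "\<sigma> \<le> sqrt n" using sum_le_sqrt_card[of a I] unit I by (simp add: \<sigma>_def)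
  have m: "0 \<le> m" "m < sqrt n" "m\<^sup>2 = real n - 1" using n by (auto simp: m_def)
  have q: "0 \<le> q" "q\<^sup>2 = 1 - 1 / n" using m n by (auto simp: q_def power_divide field_simps)
  have "((\<sigma> / sqrt n - q) / (1 - q)) ^ (n - 1) \<le> (\<Prod>i\<in>I. sqrt n * a i)"
  proof (rule power_le_prod_of_mean_square_one[OF I])
    show "0 < sqrt n * a i" if "i \<in> I" for i using n pos[OF that] by simp
    show "(\<Sum>i\<in>I. sqrt n * a i) = n * (\<sigma> / sqrt n)"
      unfolding \<sigma>_def sum_distrib_left[symmetric] using n by (simp add: field_simps flip: mult.assoc)
    show "(\<Sum>i\<in>I. (sqrt n * a i)\<^sup>2) = n"
      using unit by (simp add: power_mult_distrib flip: sum_distrib_left)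
    show "0 \<le> q" "q\<^sup>2 = 1 - 1 / n" by (fact q)+
    show "q < \<sigma> / sqrt n"
      using t n unfolding q_def by (intro divide_strict_right_mono) (auto simp: m_def \<sigma>_def)
  qed
  also have "\<sigma> / sqrt n - q = (\<sigma> - m) / sqrt n" by (simp add: q_def diff_divide_distrib)
  also have "1 - q = (sqrt n - m) / sqrt n" using n by (simp add: q_def diff_divide_distrib)
  also have "(\<sigma> - m) / sqrt n / ((sqrt n - m) / sqrt n) = (\<sigma> - m) / (sqrt n - m)" using n by simp
  also have "(\<Prod>i\<in>I. sqrt n * a i) = sqrt n ^ n * (\<Prod>i\<in>I. a i)"
    using I by (simp add: prod.distrib)
  finally have L: "((\<sigma> - m) / (sqrt n - m)) ^ (n - 1) \<le> sqrt n ^ n * (\<Prod>i\<in>I. a i)" .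
  \<comment> \<open>The monotonicity in cross-multiplied form, which also covers
    \<open>t = sqrt n / 2\<close>, where the ratio has denominator 0.\<close>
  have "(sqrt n - \<sigma>) * m \<le> (sqrt n - \<sigma>) * (2 * t)"
    using \<sigma> t by (intro mult_left_mono) (auto simp: m_def)
  then have "\<sigma> / 2 - t \<le> (\<sigma> - m) / (sqrt n - m) * (sqrt n / 2 - t)"
    using m by (simp add: field_simps)
  then have "(\<sigma> / 2 - t) ^ (n - 1) \<le> ((\<sigma> - m) / (sqrt n - m) * (sqrt n / 2 - t)) ^ (n - 1)"
    using t by (intro power_mono) (auto simp: \<sigma>_def)
  also have "\<dots> \<le> sqrt n ^ n * (\<Prod>i\<in>I. a i) * (sqrt n / 2 - t) ^ (n - 1)"
    unfolding power_mult_distrib using L t \<sigma> by (intro mult_right_mono) (auto simp: \<sigma>_def)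
  finally show ?thesis by (simp add: \<sigma>_def)
qed

lemma diagvec_inner: "b \<in> Basis \<Longrightarrow> (diagvec :: real^'n) \<bullet> b = 1 / sqrt (real CARD('n))"
  by (auto simp: Basis_vec_def diagvec_def inner_axis)

lemma sec_area_diagvec:
  assumes t: "sqrt (real CARD('n) - 1) / 2 \<le> t" "t \<le> sqrt (real CARD('n)) / 2"
  shows "sec_area (diagvec :: real^'n) t
    = sqrt (real CARD('n)) ^ CARD('n) / fact (CARD('n) - 1) * (sqrt (real CARD('n)) / 2 - t) ^ (CARD('n) - 1)"
proof -
  have n: "real CARD('n) > 0" by simp
  have "(diagvec :: real^'n) \<bullet> diagvec = 1"
    unfolding euclidean_inner[of "diagvec :: real^'n" diagvec] using n by (simp add: diagvec_inner)
  then have "norm (diagvec :: real^'n) = 1" by (simp add: norm_eq_1)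
  moreover have "(\<Sum>b\<in>Basis. (diagvec :: real^'n) \<bullet> b) = sqrt (real CARD('n))"
    by (simp add: diagvec_inner real_div_sqrt)
  moreover have "(\<Prod>b\<in>Basis. (diagvec :: real^'n) \<bullet> b) = 1 / sqrt (real CARD('n)) ^ CARD('n)"
    by (simp add: diagvec_inner power_divide)
  ultimately show ?thesis
    using t by (subst sec_area_corner) (auto simp: diagvec_inner)
qed

section \<open>The planar case and the theorem\<close>

text \<open>On the unit circle \<open>2 * x * y = (x + y)^2 - 1\<close>, so comparing areas involves
  only \<open>x + y\<close>. For \<open>x + y < sqrt 2\<close> the sign is that of the second
  factor; letting \<open>x + y\<close> tend to \<open>sqrt 2\<close> yields the critical value
  \<open>t = 3/8 * sqrt 2\<close>.\<close>

lemma planar_corner_identity: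
  fixes x y t :: real
  assumes "x\<^sup>2 + y\<^sup>2 = 1"
  shows "2 * (sqrt 2 / 2 - t) * (x * y) - ((x + y) / 2 - t)
    = (sqrt 2 - (x + y)) * (1 - (sqrt 2 - 2 * t) * (sqrt 2 + (x + y))) / 2"
proof -
  have xy: "2 * (x * y) = (x + y)\<^sup>2 - 1" using assms by (simp add: power2_eq_square algebra_simps)
  have "2 * (sqrt 2 / 2 - t) * (x * y) = (sqrt 2 - 2 * t) * (2 * (x * y)) / 2" by (simp add: field_simps)
  also have "\<dots> - ((x + y) / 2 - t)
    = (sqrt 2 - (x + y) - (sqrt 2 - 2 * t) * ((sqrt 2)\<^sup>2 - (x + y)\<^sup>2)) / 2"
    unfolding xy by (simp add: field_simps)
  also have "\<dots> = (sqrt 2 - (x + y)) * (1 - (sqrt 2 - 2 * t) * (sqrt 2 + (x + y))) / 2"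
    by (simp add: power2_eq_square algebra_simps)
  finally show ?thesis .
qed

lemma sum_Basis_2: "(\<Sum>b\<in>Basis. (v :: real^2) \<bullet> b) = v $ 1 + v $ 2"
  by (simp add: Basis_vec_def sum_2 inner_axis UNION_singleton_eq_range sum.reindex inj_on_def axis_eq_axis)

lemma prod_Basis_2: "(\<Prod>b\<in>Basis. (v :: real^2) \<bullet> b) = v $ 1 * v $ 2"
  by (simp add: Basis_vec_def inner_axis UNION_singleton_eq_range prod.reindex inj_on_def axis_eq_axis UNIV_2)

lemma norm_eq_1_vec2: "norm (v :: real^2) = 1 \<longleftrightarrow> (v $ 1)\<^sup>2 + (v $ 2)\<^sup>2 = 1"
  by (simp add: norm_eq_1 inner_vec_def sum_2 power2_eq_square)

lemma sec_area_diagvec_2: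
  assumes "1 / 2 \<le> t" "t \<le> sqrt 2 / 2"
  shows "sec_area (diagvec :: real^2) t = 2 * (sqrt 2 / 2 - t)"
  using sec_area_diagvec[where 'n = 2, of t] assms by simp

theorem theorem4:
  shows
  "(\<forall>(a::real^'n) t.
      CARD('n) \<ge> 3 \<and> sqrt (real CARD('n) - 1) / 2 < t \<and> t \<le> sqrt (real CARD('n)) / 2
      \<and> a \<in> sphere 0 1 \<longrightarrow>
        sec_area a t \<le> sec_area (diagvec :: real^'n) t \<and>
        sec_area (diagvec :: real^'n) t =
          real CARD('n) powr (real CARD('n) / 2) / fact (CARD('n) - 1)
            * (sqrt (real CARD('n)) / 2 - t) ^ (CARD('n) - 1))
   \<and> (\<forall>(a::real^2) t. 3/8 * sqrt 2 < t \<and> t \<le> 1 / sqrt 2 \<and> a \<in> sphere 0 1 \<longrightarrow>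
        sec_area a t \<le> sec_area (diagvec :: real^2) t)
   \<and> (\<forall>t. 1/2 < t \<and> t < 3/8 * sqrt 2 \<longrightarrow>
        (\<exists>a::real^2. a \<in> sphere 0 1 \<and> sec_area a t > sec_area (diagvec :: real^2) t))"
proof (intro conjI allI impI; elim conjE)
  fix a :: "real^'n" and t :: real
  let ?n = "CARD('n)"
  assume n: "?n \<ge> 3" and t: "sqrt (real ?n - 1) / 2 < t" "t \<le> sqrt (real ?n) / 2" and a: "a \<in> sphere 0 1"
  have diag: "sec_area (diagvec :: real^'n) t = sqrt ?n ^ ?n / fact (?n - 1) * (sqrt ?n / 2 - t) ^ (?n - 1)"
    using t by (intro sec_area_diagvec) auto
  have "real ?n powr (real ?n / 2) = (real ?n powr (1 / 2)) powr real ?n"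
    by (simp add: powr_powr)
  also have "\<dots> = sqrt ?n ^ ?n"
    using n by (simp add: powr_half_sqrt powr_realpow)
  finally show "sec_area (diagvec :: real^'n) t = real ?n powr (real ?n / 2) / fact (?n - 1)
      * (sqrt ?n / 2 - t) ^ (?n - 1)"
    using diag by simp
  show "sec_area a t \<le> sec_area (diagvec :: real^'n) t"
    unfolding diag
  proof (rule sec_area_le)
    show "norm a = 1" using a by simp
    show "sqrt (real DIM(real^'n) - 1) / 2 < t" using t by simp
    show "0 \<le> sqrt ?n ^ ?n / fact (?n - 1) * (sqrt ?n / 2 - t) ^ (?n - 1)" using t by simp
    fix v :: "real^'n"
    assume v: "norm v = 1" "\<And>b. b \<in> Basis \<Longrightarrow> 0 < v \<bullet> b" "t \<le> (\<Sum>b\<in>Basis. v \<bullet> b) / 2"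
    have P: "(\<Prod>b\<in>Basis. v \<bullet> b) > 0" using v(2) by (rule prod_pos)
    have "((\<Sum>b\<in>Basis. v \<bullet> b) / 2 - t) ^ (?n - 1)
        \<le> sqrt ?n ^ ?n * (\<Prod>b\<in>Basis. v \<bullet> b) * (sqrt ?n / 2 - t) ^ (?n - 1)"
    proof (rule corner_power_le_prod)
      show "(\<Sum>b\<in>Basis. (v \<bullet> b)\<^sup>2) = 1"
        using v(1) by (simp add: norm_eq_1 power2_eq_square flip: euclidean_inner)
    qed (use n v t in auto)
    then show "((\<Sum>b\<in>Basis. v \<bullet> b) / 2 - t) ^ (DIM(real^'n) - 1) / (fact (DIM(real^'n) - 1) * (\<Prod>b\<in>Basis. v \<bullet> b))
        \<le> sqrt ?n ^ ?n / fact (?n - 1) * (sqrt ?n / 2 - t) ^ (?n - 1)"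
      using P by (simp add: divide_simps mult_ac)
  qed
next
  fix a :: "real^2" and t :: real
  assume t: "3/8 * sqrt 2 < t" "t \<le> 1 / sqrt 2" and a: "a \<in> sphere 0 1"
  \<comment> \<open>Then \<open>3/8 * sqrt 2 > 21/40 > 1/2\<close>, so \<open>t\<close> exceeds the
    corner threshold for n = 2.\<close>
  have "(7 / 5 :: real) < sqrt 2" by (rule real_less_rsqrt) (simp add: power2_eq_square)
  then have t_half: "1 / 2 < t" using t by simp
  have "1 / sqrt 2 = sqrt 2 / (2 :: real)" by (simp add: field_simps)
  then have t2: "t \<le> sqrt 2 / 2" using t by simp
  show "sec_area a t \<le> sec_area (diagvec :: real^2) t"
    unfolding sec_area_diagvec_2[OF less_imp_le[OF t_half] t2]
  proof (rule sec_area_le)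
    show "norm a = 1" using a by simp
    show "sqrt (real DIM(real^2) - 1) / 2 < t" using t_half by simp
    show "0 \<le> 2 * (sqrt 2 / 2 - t)" using t2 by simp
    fix v :: "real^2"
    assume v: "norm v = 1" "\<And>b. b \<in> Basis \<Longrightarrow> 0 < v \<bullet> b" "t \<le> (\<Sum>b\<in>Basis. v \<bullet> b) / 2"
    define x y where "x = v $ 1" and "y = v $ 2"
    have pos: "0 < x" "0 < y"
      using v(2)[of "axis 1 1"] v(2)[of "axis 2 1"] by (auto simp: inner_axis axis_in_Basis_iff x_def y_def)
    have xy: "x\<^sup>2 + y\<^sup>2 = 1" using v(1) by (simp add: norm_eq_1_vec2 x_def y_def)
    have \<sigma>: "x + y \<le> sqrt 2"
    proof (rule real_le_rsqrt)
      show "(x + y)\<^sup>2 \<le> 2" using xy sum_squares_bound[of x y] by (simp add: power2_sum)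
    qed
    \<comment> \<open>The first factor is bounded by the hypothesis on \<open>t\<close>, the second
      by \<open>x + y \<le> sqrt 2\<close>.\<close>
    have "(sqrt 2 - 2 * t) * (sqrt 2 + (x + y)) \<le> (sqrt 2 / 4) * (2 * sqrt 2)"
      using t \<sigma> pos t2 by (intro mult_mono) auto
    also have "\<dots> = 1" by simp
    finally have "0 \<le> (sqrt 2 - (x + y)) * (1 - (sqrt 2 - 2 * t) * (sqrt 2 + (x + y))) / 2"
      using \<sigma> by simp
    then have "(x + y) / 2 - t \<le> 2 * (sqrt 2 / 2 - t) * (x * y)"
      unfolding planar_corner_identity[OF xy, symmetric] by simp
    then show "((\<Sum>b\<in>Basis. v \<bullet> b) / 2 - t) ^ (DIM(real^2) - 1) / (fact (DIM(real^2) - 1) * (\<Prod>b\<in>Basis. v \<bullet> b))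
        \<le> 2 * (sqrt 2 / 2 - t)"
      using pos sum_Basis_2[of v] by (simp add: prod_Basis_2 x_def y_def pos_divide_le_eq)
  qed
next
  fix t :: real
  assume t: "1/2 < t" "t < 3/8 * sqrt 2"
  define p where "p = sqrt 2 - 2 * t"
  have p: "sqrt 2 / 4 < p" using t by (simp add: p_def)
  have "0 < sqrt 2 / (4 :: real)" by simp
  then have p0: "0 < p" using p by linarith
  have "1 / p < 1 / (sqrt 2 / 4)" using p p0 by (intro divide_strict_left_mono) auto
  also have "1 / (sqrt 2 / 4) = 2 * sqrt 2" by (simp add: field_simps)
  finally have "max (2 * t) (1 / p - sqrt 2) < sqrt 2" using p0 by (simp add: p_def)
  \<comment> \<open>\<open>\<sigma>\<close> is to be a coordinate sum: above \<open>2 * t\<close>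
    the section is nonempty, above \<open>1 / p - sqrt 2\<close> the second factor of the planar
    identity is negative, and below \<open>sqrt 2\<close> it is attained by a nondiagonal unit
    vector.\<close>
  then obtain \<sigma> where \<sigma>: "max (2 * t) (1 / p - sqrt 2) < \<sigma>" "\<sigma> < sqrt 2"
    using dense by blast
  have \<sigma>1: "1 < \<sigma>" using \<sigma> t by simp
  have \<sigma>2: "\<sigma>\<^sup>2 < 2" using \<sigma>(2) \<sigma>1 by (metis less_trans real_sqrt_less_iff real_sqrt_unique zero_less_one less_imp_le)
  define r where "r = sqrt (2 - \<sigma>\<^sup>2)"
  have r: "0 \<le> r" "r\<^sup>2 = 2 - \<sigma>\<^sup>2" using \<sigma>2 by (auto simp: r_def)
  \<comment> \<open>The two numbers with sum \<open>\<sigma>\<close> and squares summing to 1; both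
    are positive because \<open>\<sigma> > 1\<close>.\<close>
  define x y where "x = (\<sigma> + r) / 2" and "y = (\<sigma> - r) / 2"
  have "1 < \<sigma>\<^sup>2" using \<sigma>1 by simp
  then have "r\<^sup>2 < \<sigma>\<^sup>2" using r by simp
  then have "r < \<sigma>" by (rule power2_less_imp_less) (use \<sigma>1 in simp)
  then have pos: "0 < x" "0 < y" using r \<sigma>1 by (auto simp: x_def y_def)
  have xy: "x\<^sup>2 + y\<^sup>2 = 1" using r(2) by (simp add: x_def y_def power2_eq_square field_simps)
  have sum: "x + y = \<sigma>" by (simp add: x_def y_def field_simps)
  define v where "v = (vector [x, y] :: real^2)"
  have v: "v $ 1 = x" "v $ 2 = y" by (simp_all add: v_def)
  have v1: "norm v = 1" using xy by (simp add: norm_eq_1_vec2 v)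
  have vpos: "0 < v \<bullet> b" if "b \<in> Basis" for b
  proof -
    obtain i where "b = axis i 1" using \<open>b \<in> Basis\<close> by (auto simp: Basis_vec_def)
    then show ?thesis using exhaust_2[of i] pos v by (auto simp: inner_axis)
  qed
  have "sec_area v t = ((\<Sum>b\<in>Basis. v \<bullet> b) / 2 - t) ^ (DIM(real^2) - 1) / (fact (DIM(real^2) - 1) * (\<Prod>b\<in>Basis. v \<bullet> b))"
    by (rule sec_area_corner[OF vpos v1 _ refl]) (use t sum_Basis_2[of v] sum \<sigma> v in auto)
  then have area: "sec_area v t = ((x + y) / 2 - t) / (x * y)"
    using sum_Basis_2[of v] by (simp add: prod_Basis_2 v)
  have "1 < p * (sqrt 2 + \<sigma>)" using \<sigma> p0 by (simp add: field_simps)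
  then have "(sqrt 2 - (x + y)) * (1 - (sqrt 2 - 2 * t) * (sqrt 2 + (x + y))) / 2 < 0"
    unfolding sum p_def[symmetric] using \<sigma>(2) by (simp add: mult_less_0_iff)
  then have "2 * (sqrt 2 / 2 - t) * (x * y) < (x + y) / 2 - t"
    unfolding planar_corner_identity[OF xy, symmetric] by simp
  then have "2 * (sqrt 2 / 2 - t) < sec_area v t"
    unfolding area using pos by (simp add: pos_less_divide_eq)
  moreover have "sec_area (diagvec :: real^2) t = 2 * (sqrt 2 / 2 - t)"
    using t p0 by (intro sec_area_diagvec_2) (auto simp: p_def)
  ultimately show "\<exists>a::real^2. a \<in> sphere 0 1 \<and> sec_area a t > sec_area (diagvec :: real^2) t"
    using v1 by (intro exI[of _ v]) simp
qed

end
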